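(* Let $p\in\mathbb{R}[x_1,\dots,x_n]$ be a homogeneous multiaffine stable polynomial and let $P=\Phi(p)$ be its minor lift. If $A\in H(P)$, then $p(\pi(A))\ge P(A)$ and $\pi(A)\in H(p)$.
   Context: $X$ is a symmetric $n\times n$ matrix of indeterminates, and $X_J$ is its principal submatrix indexed by $J\subseteq[n]=\{1,\dots,n\}$ (with $\det X_\emptyset=1$). A polynomial is multiaffine if it is a linear combination of square-free monomials. For multiaffine $p=\sum_{J\subseteq[n]}a_J\prod_{i\in J}x_i$ the minor lift is $\Phi(p)(X)=\sum_{J\subseteq[n]}a_J\det(X_J)$, a polynomial on real symmetric $n\times n$ matrices. A polynomial $p\in\mathbb{R}[x_1,\dots,x_n]$ is stable if $p(z_1,\dots,z_n)\ne0$ whenever all $z_i\in\mathbb{C}$ have positive imaginary part. A homogeneous polynomial $f$ on a real vector space $V$ is hyperbolic with respect to $a\in V$ if $f(a)\neq0$ and for every $v\in V$ the polynomial $f(v-ta)$ in $t$ has only real roots; its hyperbolicity cone is the set of $v\in V$ such that all roots of $f(v-ta)$ are nonnegative. If $p$ is homogeneous, multiaffine and stable, then $p$ is hyperbolic with respect to $\mathbf 1=(1,\dots,1)$ and $P=\Phi(p)$ is hyperbolic with respect to the identity matrix; $H(p)$ and $H(P)$ denote the corresponding hyperbolicity cones. For a real symmetric $n\times n$ matrix $A$, $\pi(A)=(A_{11},\dots,A_{nn})$.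
   Formalization: The inequality p(π(A)) ≥ P(A) is proved under the normalization p(1,…,1) > 0, since it fails for p = −x₁x₂ with A = [[1,1/2],[1/2,1]]; the claim π(A) ∈ H(p) is proved without this condition. *)

theory Defs
  imports "HOL-Analysis.Analysis" "HOL-Library.Poly_Mapping"
begin

text \<open>
  The index set \<open>[n]\<close> is a finite type \<open>'n\<close>. A polynomial in the variables
  \<open>x\<^sub>i\<close> (\<open>i :: 'n\<close>) is a finitely supported map from monomials (exponent vectors)
  to real coefficients.
\<close>

type_synonym 'n rpoly = "('n \<Rightarrow>\<^sub>0 nat) \<Rightarrow>\<^sub>0 real"

definition eval_poly :: "('n::finite) rpoly \<Rightarrow> ('a::real_field) ^ 'n \<Rightarrow> 'a" where
  "eval_poly p x =
     (\<Sum>m\<in>Poly_Mapping.keys p.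
        of_real (Poly_Mapping.lookup p m) * (\<Prod>i\<in>UNIV. (x $ i) ^ Poly_Mapping.lookup m i))"

definition homogeneous :: "('n::finite) rpoly \<Rightarrow> bool" where
  "homogeneous p \<longleftrightarrow>
     (\<exists>d. \<forall>m\<in>Poly_Mapping.keys p. (\<Sum>i\<in>UNIV. Poly_Mapping.lookup m i) = d)"

definition multiaffine :: "('n::finite) rpoly \<Rightarrow> bool" where
  "multiaffine p \<longleftrightarrow> (\<forall>m\<in>Poly_Mapping.keys p. \<forall>i. Poly_Mapping.lookup m i \<le> 1)"

definition stable_poly :: "('n::finite) rpoly \<Rightarrow> bool" where
  "stable_poly p \<longleftrightarrow> (\<forall>z :: complex ^ 'n. (\<forall>i. Im (z $ i) > 0) \<longrightarrow> eval_poly p z \<noteq> 0)"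

definition squarefree_monom :: "('n::finite) set \<Rightarrow> ('n \<Rightarrow>\<^sub>0 nat)" where
  "squarefree_monom J = (\<Sum>i\<in>J. Poly_Mapping.single i 1)"

text \<open>
  The determinant of the principal submatrix indexed by \<open>J\<close>: the library's formula for
  \<^const>\<open>det\<close> with the index type replaced by the subset \<open>J\<close>.
\<close>

definition principal_minor :: "real ^ 'n ^ 'n \<Rightarrow> ('n::finite) set \<Rightarrow> real" where
  "principal_minor A J =
     (\<Sum>\<sigma> | \<sigma> permutes J. of_int (sign \<sigma>) * (\<Prod>i\<in>J. A $ i $ \<sigma> i))"

lemma principal_minor_UNIV: "principal_minor A UNIV = det A"
  by (simp add: principal_minor_def det_def)

lemma principal_minor_empty: "principal_minor A {} = 1"
  by (simp add: principal_minor_def)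

text \<open>Meant for multiaffine \<open>p\<close>; all other coefficients of \<open>p\<close> are ignored.\<close>

definition minor_lift :: "('n::finite) rpoly \<Rightarrow> real ^ 'n ^ 'n \<Rightarrow> real" where
  "minor_lift p A =
     (\<Sum>J\<in>UNIV. Poly_Mapping.lookup p (squarefree_monom J) * principal_minor A J)"

text \<open>
  Meant for \<open>f\<close> hyperbolic with respect to \<open>a\<close>, where every root of \<open>f (v - t a)\<close> in \<open>t\<close>
  is real, so that it suffices to let \<open>t\<close> range over the reals. For \<open>f\<close> on symmetric
  matrices, the ambient space is that of symmetric matrices: the cone consists of the
  symmetric members of the set below.
\<close>

definition hyperbolicity_cone :: "(('v::real_vector) \<Rightarrow> real) \<Rightarrow> 'v \<Rightarrow> 'v set" where
  "hyperbolicity_cone f a = {v. \<forall>t::real. f (v - t *\<^sub>R a) = 0 \<longrightarrow> 0 \<le> t}"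

definition diag_vec :: "real ^ 'n ^ 'n \<Rightarrow> real ^ ('n::finite)" where
  "diag_vec A = (\<chi> i. A $ i $ i)"

text \<open>
  A pitfall about signs: \<open>p\<close> and \<open>- p\<close> are homogeneous, multiaffine and stable together,
  and they have the same cones, so an inequality \<open>p(\<pi>(A)) \<ge> P(A)\<close> can only hold for one
  choice of sign (for \<open>p = - x\<^sub>1 x\<^sub>2\<close> it reads \<open>- A\<^sub>1\<^sub>1 A\<^sub>2\<^sub>2 \<ge> - det A\<close>). It is
  meant for the usual normalization of hyperbolic polynomials, \<open>p(1,\<dots>,1) > 0\<close>.
\<close>

end

theory Submission
  imports Defs "HOL-Computational_Algebra.Fundamental_Theorem_Algebra"
begin

text \<open>
  Let \<open>d\<close> be the degree of \<open>p\<close>, let \<open>L = p(1,\<dots>,1)\<close>, and let \<open>P\<close> be the minor lift. The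
  idea is to make the symmetric matrix \<open>A\<close> diagonal one index at a time and to watch the
  polynomial \<open>t \<mapsto> P(A + tI) / L\<close>, which decides both the membership in the cone and, at
  \<open>t = 0\<close>, the value of \<open>P\<close>. On a diagonal matrix \<open>P\<close> is \<open>p\<close>.

  Conjugation by the diagonal matrix that has \<open>-1\<close> at \<open>i\<close> and \<open>1\<close> elsewhere changes the sign
  of the entries that lie in row or column \<open>i\<close> but not on the diagonal, and it preserves all
  principal minors. So if these entries are multiplied by \<open>s\<close>, then \<open>P\<close> becomes an even
  polynomial in \<open>s\<close>, and since each term of a determinant takes at most two of them,
  it is \<open>P(A\<^sub>0) + s\<^sup>2 (P(A) - P(A\<^sub>0))\<close>, where \<open>A\<^sub>0\<close> is \<open>A\<close> with these entries set to \<open>0\<close>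
  (\<open>lift_scale_cross\<close>). With \<open>w = s\<^sup>2\<close> and with \<open>a(t)\<close>, \<open>b(t)\<close> the polynomials of \<open>A\<^sub>0\<close>, \<open>A\<close>,
  all members of the pencil \<open>a + w (b - a)\<close> for \<open>w \<ge> 0\<close> are real-rooted, because each is
  the restriction of \<open>P\<close> to a line in the direction of the identity matrix. They are monic of
  degree \<open>d\<close>, and the sums of their roots agree, because the coefficient of \<open>t\<^bsup>d-1\<^esup>\<close> involves
  only the diagonal of the matrix. If \<open>b\<close> is positive for \<open>t > 0\<close>, as it is for \<open>A\<close> in the
  cone, then such a pencil satisfies \<open>b \<le> a\<close> there (\<open>real_rooted_pencil_le\<close>):
  if \<open>b(t) > a(t)\<close>, then the roots stay to the left of \<open>t\<close> for all
  \<open>w \<ge> 1\<close>, and as their sum is constant they stay bounded, so the value at \<open>t\<close> is bounded;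
  but it grows linearly in \<open>w\<close>. Hence passing from \<open>A\<close> to \<open>A\<^sub>0\<close> keeps the matrix in the
  cone and does not decrease \<open>P / L\<close>; repeating this for every \<open>i\<close> gives the theorem.

  It remains to see that \<open>P\<close> is hyperbolic with respect to the identity matrix, that is,
  \<open>P(M + zI) \<noteq> 0\<close> for real symmetric \<open>M\<close> and \<open>z\<close> in the upper half-plane
  (\<open>lift_nonzero_upper_half_plane\<close>). The principal minors of \<open>Z = M + (z/2) I\<close> are, up to sign,
  the coefficients of \<open>q(y) = det (1 - diag(y) Z)\<close>, which has no zeros for \<open>y\<close> in the closed
  upper half-plane. Replacing \<open>y\<^sub>i\<close> by \<open>- \<partial>/\<partial>x\<^sub>i\<close> in \<open>p(x) q(y)\<close>, for one \<open>i\<close> at a time,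
  creates no zeros by a lemma of Lieb and Sokal, and the result at \<open>x = (z/2,\<dots>,z/2)\<close> is
  \<open>P(Z + (z/2) I)\<close>.
\<close>

section \<open>Principal minors and the minor lift over a commutative ring\<close>

text \<open>
  Hyperbolicity is a statement about zeros with complex entries, so minors of
  complex matrices are needed besides the real ones.
\<close>

definition pminor :: "('n \<Rightarrow> 'n \<Rightarrow> 'a::comm_ring_1) \<Rightarrow> 'n set \<Rightarrow> 'a" where
  "pminor M J = (\<Sum>\<sigma> | \<sigma> permutes J. of_int (sign \<sigma>) * (\<Prod>i\<in>J. M i (\<sigma> i)))"

definition lift :: "('n::finite set \<Rightarrow> 'a::comm_ring_1) \<Rightarrow> ('n \<Rightarrow> 'n \<Rightarrow> 'a) \<Rightarrow> 'a" where
  "lift a M = (\<Sum>J\<in>UNIV. a J * pminor M J)"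

definition add_diag :: "('n \<Rightarrow> 'n \<Rightarrow> 'a::comm_ring_1) \<Rightarrow> ('n \<Rightarrow> 'a) \<Rightarrow> 'n \<Rightarrow> 'n \<Rightarrow> 'a" where
  "add_diag M x = (\<lambda>i j. M i j + (if i = j then x i else 0))"

lemma pminor_empty [simp]: "pminor M {} = 1"
  by (simp add: pminor_def)

lemma pminor_singleton [simp]: "pminor M {i} = M i i"
  by (simp add: pminor_def)

text \<open>
  In a term of the determinant that takes the summands \<open>x i\<close> at \<open>i \<in> J - K\<close> and entries of \<open>M\<close> at
  \<open>K\<close>, the permutation must fix \<open>J - K\<close> and hence permutes \<open>K\<close>.
\<close>

lemma pminor_add_diag:
  assumes "finite J"
  shows "pminor (add_diag M x) J = (\<Sum>K\<in>Pow J. pminor M K * (\<Prod>i\<in>J - K. x i))"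
proof -
  let ?P = "{\<sigma>. \<sigma> permutes J}"
  let ?t = "\<lambda>\<sigma> K. of_int (sign \<sigma>) * ((\<Prod>i\<in>K. M i (\<sigma> i)) * (\<Prod>i\<in>J - K. if i = \<sigma> i then x i else 0))"
  have fin: "finite ?P" using assms by (rule finite_permutations)
  have sub: "(\<Sum>\<sigma>\<in>?P. ?t \<sigma> K) = pminor M K * (\<Prod>i\<in>J - K. x i)" if K: "K \<subseteq> J" for K
  proof -
    have "(\<Sum>\<sigma>\<in>?P. ?t \<sigma> K) = (\<Sum>\<sigma> | \<sigma> permutes K. ?t \<sigma> K)"
    proof (rule sum.mono_neutral_right[OF fin])
      show "{\<sigma>. \<sigma> permutes K} \<subseteq> ?P" using permutes_subset[OF _ K] by blast
      show "\<forall>\<sigma>\<in>?P - {\<sigma>. \<sigma> permutes K}. ?t \<sigma> K = 0"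
      proof
        fix \<sigma> assume \<sigma>: "\<sigma> \<in> ?P - {\<sigma>. \<sigma> permutes K}"
        then obtain i where i: "i \<in> J - K" "\<sigma> i \<noteq> i" using permutes_superset[of \<sigma> J K] by blast
        then have "(\<Prod>i\<in>J - K. if i = \<sigma> i then x i else 0) = 0"
          using assms i(1) i(2)[symmetric] by (intro prod_zero bexI[of _ i]) auto
        then show "?t \<sigma> K = 0" by simp
      qed
    qed
    also have "\<dots> = (\<Sum>\<sigma> | \<sigma> permutes K. of_int (sign \<sigma>) * (\<Prod>i\<in>K. M i (\<sigma> i)) * (\<Prod>i\<in>J - K. x i))"
    proof (rule sum.cong[OF refl])
      fix \<sigma> assume "\<sigma> \<in> {\<sigma>. \<sigma> permutes K}"
      then have "(\<Prod>i\<in>J - K. if i = \<sigma> i then x i else 0) = (\<Prod>i\<in>J - K. x i)"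
        by (intro prod.cong) (auto simp: permutes_not_in)
      then show "?t \<sigma> K = of_int (sign \<sigma>) * (\<Prod>i\<in>K. M i (\<sigma> i)) * (\<Prod>i\<in>J - K. x i)"
        by (simp only: mult.assoc)
    qed
    finally show ?thesis by (simp add: pminor_def sum_distrib_right)
  qed
  have "pminor (add_diag M x) J = (\<Sum>\<sigma>\<in>?P. \<Sum>K\<in>Pow J. ?t \<sigma> K)"
    unfolding pminor_def add_diag_def prod_add[OF assms] sum_distrib_left by simp
  also have "\<dots> = (\<Sum>K\<in>Pow J. \<Sum>\<sigma>\<in>?P. ?t \<sigma> K)" by (rule sum.swap)
  also have "\<dots> = (\<Sum>K\<in>Pow J. pminor M K * (\<Prod>i\<in>J - K. x i))"
    by (rule sum.cong) (auto simp: sub)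
  finally show ?thesis .
qed

lemma pminor_scale_rows: "pminor (\<lambda>i j. c i * M i j) J = (\<Prod>i\<in>J. c i) * pminor M J"
  by (simp add: pminor_def prod.distrib sum_distrib_left mult.left_commute)

lemma lift_add_diag:
  "lift a (add_diag M x) = (\<Sum>J\<in>UNIV. a J * (\<Sum>K\<in>Pow J. pminor M K * (\<Prod>i\<in>J - K. x i)))"
  by (simp add: lift_def pminor_add_diag)

lemma lift_of_real:
  "lift (\<lambda>J. complex_of_real (a J)) (\<lambda>i j. of_real (M i j)) = of_real (lift a M)"
  by (simp add: lift_def pminor_def)

lemma lift_cnj: "lift (\<lambda>J. cnj (a J)) (\<lambda>i j. cnj (M i j)) = cnj (lift a M)"
  by (simp add: lift_def pminor_def cnj_sum cnj_prod)

lemma lift_add_diag_zero: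
  fixes a :: "'n::finite set \<Rightarrow> 'a::comm_ring_1"
  shows "lift a (add_diag (\<lambda>_ _. 0) x) = (\<Sum>J\<in>UNIV. a J * (\<Prod>i\<in>J. x i))"
proof -
  have z: "pminor (\<lambda>_ _. 0::'a) K = 0" if "K \<noteq> {}" for K :: "'n set"
  proof -
    have "(\<Prod>i\<in>K. 0::'a) = 0" using that by (simp add: power_0_left)
    then show ?thesis unfolding pminor_def by (simp only: mult_zero_right sum.neutral_const)
  qed
  have "(\<Sum>K\<in>Pow J. pminor (\<lambda>_ _. 0::'a) K * (\<Prod>i\<in>J - K. x i)) = (\<Sum>K\<in>{{}}. \<Prod>i\<in>J - K. x i)" for J
    by (rule sum.mono_neutral_cong_right) (auto simp: z)
  then show ?thesis by (simp add: lift_add_diag)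
qed

section \<open>Contraction of stable multiaffine polynomials\<close>

text \<open>
  The Lieb--Sokal lemma for one pair of variables: the operator that replaces \<open>y\<close> by
  \<open>- \<partial>/\<partial>x\<close> maps the given polynomial to \<open>\<alpha> + \<beta> x - \<delta>\<close>. Writing the polynomial as
  \<open>p(x) + y \<delta> (x - r)\<close> with \<open>p(x) = \<alpha> + \<beta> x\<close>, the assumption forces \<open>r\<close> out of the open upper
  half-plane, so a zero \<open>p(x) = \<delta>\<close> of the image yields a zero of the original at the
  admissible point \<open>y = -1 / (x - r)\<close>. That \<open>y\<close> ranges over the closed half-plane makes the
  conclusion hold strictly: for \<open>\<delta> = 0\<close> the point is \<open>y = 0\<close>.
\<close>

lemma contract_pair_nonzero:
  fixes \<alpha> \<beta> \<gamma> \<delta> :: complex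
  assumes nz: "\<And>x y. Im x > 0 \<Longrightarrow> Im y \<ge> 0 \<Longrightarrow> \<alpha> + \<beta> * x + \<gamma> * y + \<delta> * x * y \<noteq> 0"
    and x: "Im x > 0"
  shows "\<alpha> + \<beta> * x - \<delta> \<noteq> 0"
proof
  assume eq: "\<alpha> + \<beta> * x - \<delta> = 0"
  have \<delta>: "\<delta> \<noteq> 0" using nz[of x 0] x eq by auto
  define r where "r = - \<gamma> / \<delta>"
  have \<gamma>: "\<gamma> = - \<delta> * r" using \<delta> by (simp add: r_def)
  show False
  proof (cases "Im r > 0")
    case False
    have im: "Im (x - r) > 0" using False x by simp
    then have ne: "x - r \<noteq> 0" by auto
    have "Im (- 1 / (x - r)) > 0" using im by (auto simp: Im_divide sum_power2_gt_zero_iff intro!: divide_neg_pos)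
    moreover have "\<alpha> + \<beta> * x + \<gamma> * (- 1 / (x - r)) + \<delta> * x * (- 1 / (x - r)) = 0"
    proof -
      have "\<alpha> + \<beta> * x + \<gamma> * (- 1 / (x - r)) + \<delta> * x * (- 1 / (x - r))
         = (\<alpha> + \<beta> * x) - \<delta> * ((x - r) / (x - r))"
        unfolding \<gamma> diff_divide_distrib by (simp add: algebra_simps)
      also have "(x - r) / (x - r) = 1" using ne by simp
      finally show ?thesis using eq by simp
    qed
    ultimately show False using nz[of x "- 1 / (x - r)"] x by simp
  next
    case True
    (* Near r the zero in y is -(p + \<beta> h) / (\<delta> h), which has a pole at h = 0. The step h is
       chosen so that this zero is i n up to a constant, hence lies in the upper half-plane,
       and n so large that r + h does too. *)
    define p where "p = \<alpha> + \<beta> * r"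
    have p: "p \<noteq> 0" using nz[of r 0] True by (simp add: p_def)
    obtain n :: nat where n: "real n > max (norm (p / \<delta>) / Im r) (norm (\<beta> / \<delta>))"
      using reals_Archimedean2 by blast
    have n0: "real n > 0" using n True
      by (smt (verit) max.strict_boundedE norm_ge_zero)
    define h where "h = - p / (\<delta> * (\<i> * of_nat n))"
    have h: "h \<noteq> 0" using p \<delta> n0 by (simp add: h_def)
    have "norm h = norm (p / \<delta>) / real n" by (simp add: h_def norm_divide norm_mult)
    also have "\<dots> < Im r" using n True n0 by (simp add: field_simps)
    finally have "Im (r + h) > 0" using abs_Im_le_cmod[of h] by simp
    moreover define y where "y = - (p + \<beta> * h) / (\<delta> * h)"
    have yeq: "y = \<i> * of_nat n - \<beta> / \<delta>" using h \<delta> p n0 unfolding y_def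
      by (simp add: field_simps) (simp add: h_def field_simps)
    have "Im (\<beta> / \<delta>) < real n"
      using n abs_Im_le_cmod[of "\<beta> / \<delta>"] unfolding max_less_iff_conj by linarith
    then have "Im y \<ge> 0" by (simp add: yeq)
    moreover have "\<alpha> + \<beta> * (r + h) + \<gamma> * y + \<delta> * (r + h) * y = 0"
    proof -
      have "\<alpha> + \<beta> * (r + h) + \<gamma> * y + \<delta> * (r + h) * y = p + \<beta> * h + y * (\<delta> * h)"
        unfolding \<gamma> p_def by (simp add: algebra_simps)
      then show ?thesis using h \<delta> by (simp add: y_def)
    qed
    ultimately show False using nz by blast
  qed
qed


text \<open>
  The polynomial \<open>\<Sum>\<^sub>J \<Sum>\<^sub>K w J K x\<^sup>J y\<^sup>K\<close> after \<open>y\<^sub>i\<close> has been replaced by \<open>- \<partial>/\<partial>x\<^sub>i\<close> for all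
  \<open>i \<in> S\<close>. In the pair \<open>x\<^sub>i, y\<^sub>i\<close> this maps \<open>1, x, y, x y\<close> to \<open>1, x, 0, -1\<close>; the images of
  \<open>y\<close> and \<open>x y\<close> form the first branch of the product.
\<close>

definition partly_contracted ::
  "('n::finite set \<Rightarrow> 'n set \<Rightarrow> complex) \<Rightarrow> 'n set \<Rightarrow> ('n \<Rightarrow> complex) \<Rightarrow> ('n \<Rightarrow> complex) \<Rightarrow> complex" where
  "partly_contracted w S x y =
     (\<Sum>J\<in>UNIV. \<Sum>K\<in>UNIV. w J K *
       (\<Prod>i\<in>UNIV. if i \<in> S \<and> i \<in> K then if i \<in> J then -1 else 0
                else (if i \<in> J then x i else 1) * (if i \<in> K then y i else 1)))"

text \<open>
  For fixed values of all other variables the polynomial is affine in each of \<open>x\<^sub>i\<close> and \<open>y\<^sub>i\<close>,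
  so the pairs can be contracted one after the other.
\<close>

lemma partly_contracted_nonzero:
  fixes w :: "'n::finite set \<Rightarrow> 'n set \<Rightarrow> complex"
  assumes nz: "\<And>x y. (\<And>i. Im (x i) > 0) \<Longrightarrow> (\<And>i. Im (y i) \<ge> 0) \<Longrightarrow> partly_contracted w {} x y \<noteq> 0"
  shows "(\<And>i. Im (x i) > 0) \<Longrightarrow> (\<And>i. Im (y i) \<ge> 0) \<Longrightarrow> partly_contracted w S x y \<noteq> 0"
  using finite[of S]
proof (induction S arbitrary: x y rule: finite_induct)
  case empty
  then show ?case using nz by blast
next
  case (insert i S)
  define u where "u J K = w J K * (\<Prod>j\<in>-{i}. if j \<in> S \<and> j \<in> K then if j \<in> J then -1 else 0
                else (if j \<in> J then x j else 1) * (if j \<in> K then y j else 1))" for J K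
  define c where "c p q = (\<Sum>J\<in>UNIV. \<Sum>K\<in>UNIV. if (i \<in> J) = p \<and> (i \<in> K) = q then u J K else 0)" for p q
  have split: "(\<Prod>j\<in>UNIV. f j) = f i * (\<Prod>j\<in>-{i}. f j)" for f :: "'n \<Rightarrow> complex"
    using prod.remove[of UNIV i f] by (simp add: Compl_eq_Diff_UNIV)
  (* c p q is the coefficient of x^p y^q in the pair of variables with index i, where the
     truth values p and q stand for exponents; the other variables are part of c. *)
  have old: "partly_contracted w S (x(i := s)) (y(i := t))
      = c False False + c True False * s + c False True * t + c True True * s * t" for s t
  proof -
    have "partly_contracted w S (x(i := s)) (y(i := t)) = (\<Sum>J\<in>UNIV. \<Sum>K\<in>UNIV. u J K *
       ((if i \<in> J then s else 1) * (if i \<in> K then t else 1)))"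
      unfolding partly_contracted_def
    proof (intro sum.cong refl)
      fix J K :: "'n set"
      have "(\<Prod>j\<in>-{i}. if j \<in> S \<and> j \<in> K then if j \<in> J then -1 else 0
              else (if j \<in> J then (x(i := s)) j else 1) * (if j \<in> K then (y(i := t)) j else 1))
          = (\<Prod>j\<in>-{i}. if j \<in> S \<and> j \<in> K then if j \<in> J then -1 else 0
              else (if j \<in> J then x j else 1) * (if j \<in> K then y j else 1))"
        by (intro prod.cong) auto
      then show "w J K * (\<Prod>j\<in>UNIV. if j \<in> S \<and> j \<in> K then if j \<in> J then -1 else 0
              else (if j \<in> J then (x(i := s)) j else 1) * (if j \<in> K then (y(i := t)) j else 1))
          = u J K * ((if i \<in> J then s else 1) * (if i \<in> K then t else 1))"
        unfolding split u_def using insert.hyps by simp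
    qed
    also have "\<dots> = c False False + c True False * s + c False True * t + c True True * s * t"
      unfolding c_def sum_distrib_right sum.distrib[symmetric]
      by (intro sum.cong refl) auto
    finally show ?thesis .
  qed
  have new: "partly_contracted w (insert i S) x y = c False False + c True False * x i - c True True"
  proof -
    have "partly_contracted w (insert i S) x y = (\<Sum>J\<in>UNIV. \<Sum>K\<in>UNIV. u J K *
       (if i \<in> K then if i \<in> J then -1 else 0 else if i \<in> J then x i else 1))"
      unfolding partly_contracted_def
    proof (intro sum.cong refl)
      fix J K :: "'n set"
      have "(\<Prod>j\<in>-{i}. if j \<in> insert i S \<and> j \<in> K then if j \<in> J then -1 else 0
              else (if j \<in> J then x j else 1) * (if j \<in> K then y j else 1))
          = (\<Prod>j\<in>-{i}. if j \<in> S \<and> j \<in> K then if j \<in> J then -1 else 0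
              else (if j \<in> J then x j else 1) * (if j \<in> K then y j else 1))"
        by (intro prod.cong) auto
      then show "w J K * (\<Prod>j\<in>UNIV. if j \<in> insert i S \<and> j \<in> K then if j \<in> J then -1 else 0
              else (if j \<in> J then x j else 1) * (if j \<in> K then y j else 1))
          = u J K * (if i \<in> K then if i \<in> J then -1 else 0 else if i \<in> J then x i else 1)"
        unfolding split u_def by simp
    qed
    also have "\<dots> = c False False + c True False * x i - c True True"
      unfolding c_def sum_distrib_right sum.distrib[symmetric] sum_subtractf[symmetric]
      by (intro sum.cong refl) auto
    finally show ?thesis .
  qed
  have "c False False + c True False * s + c False True * t + c True True * s * t \<noteq> 0"
    if "Im s > 0" "Im t \<ge> 0" for s t
    unfolding old[symmetric] using that insert.prems by (intro insert.IH) auto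
  then show ?case
    unfolding new using insert.prems by (intro contract_pair_nonzero) auto
qed

text \<open>
  After all pairs are contracted, a term \<open>x\<^sup>J y\<^sup>K\<close> survives only for \<open>K \<subseteq> J\<close> and becomes
  \<open>(-1)\<^bsup>|K|\<^esup> x\<^bsup>J - K\<^esup>\<close>. The signs in the second assumption compensate for this power of \<open>-1\<close>.
\<close>

lemma contraction_nonzero:
  fixes a c :: "'n::finite set \<Rightarrow> complex"
  assumes a: "\<And>x. (\<And>i. Im (x i) > 0) \<Longrightarrow> (\<Sum>J\<in>UNIV. a J * (\<Prod>i\<in>J. x i)) \<noteq> 0"
    and c: "\<And>y. (\<And>i. Im (y i) \<ge> 0) \<Longrightarrow> (\<Sum>K\<in>UNIV. c K * (\<Prod>i\<in>K. - y i)) \<noteq> 0"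
    and x: "\<And>i. Im (x i) > 0"
  shows "(\<Sum>J\<in>UNIV. a J * (\<Sum>K\<in>Pow J. c K * (\<Prod>i\<in>J - K. x i))) \<noteq> 0"
proof -
  define w where "w J K = a J * (c K * (-1) ^ card K)" for J K :: "'n set"
  have ind: "(\<Prod>i\<in>UNIV. if i \<in> J then f i else 1) = (\<Prod>i\<in>J. f i)" for f :: "'n \<Rightarrow> complex" and J
    by (simp add: prod.If_cases)
  have start: "partly_contracted w {} x y \<noteq> 0"
    if "\<And>i. Im (x i) > 0" "\<And>i. Im (y i) \<ge> 0" for x y
  proof -
    have "partly_contracted w {} x y
        = (\<Sum>J\<in>UNIV. a J * (\<Prod>i\<in>J. x i)) * (\<Sum>K\<in>UNIV. c K * (\<Prod>i\<in>K. - y i))"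
      unfolding partly_contracted_def sum_product
      by (intro sum.cong refl) (simp add: prod.distrib ind w_def prod_uminus algebra_simps)
    then show ?thesis using a[OF that(1)] c[OF that(2)] by simp
  qed
  have "partly_contracted w UNIV x (\<lambda>_. 0) \<noteq> 0"
    by (rule partly_contracted_nonzero[OF start x]) simp_all
  also have "partly_contracted w UNIV x (\<lambda>_. 0)
      = (\<Sum>J\<in>UNIV. a J * (\<Sum>K\<in>Pow J. c K * (\<Prod>i\<in>J - K. x i)))"
    unfolding partly_contracted_def
  proof (intro sum.cong refl)
    fix J :: "'n set"
    define g where "g K i = (if i \<in> UNIV \<and> i \<in> K then if i \<in> J then -1 else 0
        else (if i \<in> J then x i else 1) * (if i \<in> K then 0 else 1))" for K i
    have g0: "prod (g K) UNIV = 0" if "\<not> K \<subseteq> J" for K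
      using that by (intro prod_zero) (auto simp: g_def)
    have g1: "prod (g K) UNIV = (-1) ^ card K * (\<Prod>i\<in>J - K. x i)" if K: "K \<subseteq> J" for K
    proof -
      have "prod (g K) UNIV = (\<Prod>i\<in>UNIV. (if i \<in> K then -1 else 1) * (if i \<in> J - K then x i else 1))"
        using K by (intro prod.cong) (auto simp: g_def)
      then show ?thesis unfolding prod.distrib ind by simp
    qed
    have "(\<Sum>K\<in>UNIV. w J K * prod (g K) UNIV) = (\<Sum>K\<in>Pow J. w J K * prod (g K) UNIV)"
      by (rule sum.mono_neutral_right) (auto simp: g0)
    also have "\<dots> = (\<Sum>K\<in>Pow J. a J * (c K * (\<Prod>i\<in>J - K. x i)))"
      by (intro sum.cong refl) (auto simp: g1 w_def power_mult_distrib[symmetric] simp flip: mult.assoc)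
    finally show "(\<Sum>K\<in>UNIV. w J K * (\<Prod>i\<in>UNIV. if i \<in> UNIV \<and> i \<in> K then if i \<in> J then -1 else 0
        else (if i \<in> J then x i else 1) * (if i \<in> K then 0 else 1)))
      = a J * (\<Sum>K\<in>Pow J. c K * (\<Prod>i\<in>J - K. x i))"
      by (simp add: g_def sum_distrib_left)
  qed
  finally show ?thesis .
qed

section \<open>Hyperbolicity of the minor lift\<close>

text \<open>
  A kernel vector \<open>v\<close> satisfies \<open>v\<^sub>i = y\<^sub>i w\<^sub>i\<close> with \<open>w = Z v\<close>. The number \<open>q = v\<^sup>* Z v\<close> then has
  two incompatible descriptions: \<open>q = \<Sum>\<^sub>i cnj y\<^sub>i |w\<^sub>i|\<^sup>2\<close> has imaginary part at most \<open>0\<close>, while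
  \<open>q = v\<^sup>* M v + \<zeta> |v|\<^sup>2\<close> with a real first summand has positive imaginary part.
\<close>

lemma det_upper_half_plane_nonzero:
  fixes M :: "'n::finite \<Rightarrow> 'n \<Rightarrow> real" and y :: "'n \<Rightarrow> complex"
  assumes sym: "\<And>i j. M i j = M j i" and \<zeta>: "Im \<zeta> > 0" and y: "\<And>i. Im (y i) \<ge> 0"
  defines "Z \<equiv> add_diag (\<lambda>i j. complex_of_real (M i j)) (\<lambda>_. \<zeta>)"
  shows "det (\<chi> i j. add_diag (\<lambda>i j. - y i * Z i j) (\<lambda>_. 1) i j) \<noteq> 0"
proof
  let ?B = "(\<chi> i j. add_diag (\<lambda>i j. - y i * Z i j) (\<lambda>_. 1) i j) :: complex^'n^'n"
  assume "det ?B = 0"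
  then have "\<not> invertible ?B" by (simp add: invertible_det_nz)
  then obtain v where v: "?B *v v = 0" "v \<noteq> 0"
    using matrix_left_invertible_ker[of ?B] by (auto simp: invertible_left_inverse)
  define w where "w i = (\<Sum>j\<in>UNIV. Z i j * v $ j)" for i
  have vw: "v $ i = y i * w i" for i
  proof -
    have "(?B *v v) $ i = (\<Sum>j\<in>UNIV. (if i = j then v $ j else 0) - y i * (Z i j * v $ j))"
      unfolding matrix_vector_mult_def by (auto simp: add_diag_def algebra_simps intro!: sum.cong)
    also have "\<dots> = v $ i - y i * w i"
      by (simp add: sum_subtractf w_def sum_distrib_left)
    finally show ?thesis using v by simp
  qed
  define q where "q = (\<Sum>i\<in>UNIV. cnj (v $ i) * w i)"
  have "q = (\<Sum>i\<in>UNIV. cnj (y i) * of_real ((cmod (w i))\<^sup>2))"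
    unfolding q_def by (intro sum.cong refl) (simp only: vw complex_norm_square complex_cnj_mult mult_ac)
  then have "Im q = - (\<Sum>i\<in>UNIV. Im (y i) * (cmod (w i))\<^sup>2)"
    by (simp add: sum_negf)
  moreover have "0 \<le> (\<Sum>i\<in>UNIV. Im (y i) * (cmod (w i))\<^sup>2)"
    using y by (intro sum_nonneg mult_nonneg_nonneg) auto
  ultimately have le: "Im q \<le> 0" by simp
  define h where "h = (\<Sum>i\<in>UNIV. \<Sum>j\<in>UNIV. cnj (v $ i) * of_real (M i j) * v $ j)"
  have "cnj h = (\<Sum>i\<in>UNIV. \<Sum>j\<in>UNIV. cnj (v $ j) * of_real (M j i) * v $ i)"
    unfolding h_def by (simp add: cnj_sum mult.commute mult.left_commute sym)
  also have "\<dots> = h" unfolding h_def by (rule sum.swap)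
  finally have "Im h = 0" by (simp add: complex_eq_iff)
  have "q = h + (\<Sum>i\<in>UNIV. cnj (v $ i) * (\<zeta> * v $ i))"
    unfolding q_def h_def sum.distrib[symmetric]
  proof (intro sum.cong refl)
    fix i
    have "w i = (\<Sum>j\<in>UNIV. of_real (M i j) * v $ j + (if i = j then \<zeta> * v $ j else 0))"
      unfolding w_def Z_def add_diag_def by (intro sum.cong refl) (simp add: algebra_simps)
    then have "w i = (\<Sum>j\<in>UNIV. of_real (M i j) * v $ j) + \<zeta> * v $ i"
      by (simp add: sum.distrib)
    then show "cnj (v $ i) * w i = (\<Sum>j\<in>UNIV. cnj (v $ i) * of_real (M i j) * v $ j)
        + cnj (v $ i) * (\<zeta> * v $ i)"
      by (simp add: distrib_left sum_distrib_left mult.assoc)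
  qed
  also have "(\<Sum>i\<in>UNIV. cnj (v $ i) * (\<zeta> * v $ i)) = \<zeta> * of_real (\<Sum>i\<in>UNIV. (cmod (v $ i))\<^sup>2)"
    unfolding of_real_sum sum_distrib_left
    by (intro sum.cong refl) (simp only: complex_norm_square mult_ac)
  finally have "Im q = Im \<zeta> * (\<Sum>i\<in>UNIV. (cmod (v $ i))\<^sup>2)" using \<open>Im h = 0\<close> by simp
  moreover obtain k where "v $ k \<noteq> 0" using v(2) by (auto simp: vec_eq_iff)
  then have "(\<Sum>i\<in>UNIV. (cmod (v $ i))\<^sup>2) > 0" by (intro sum_pos2[of _ k]) auto
  ultimately show False using le \<zeta> by (simp add: mult_le_0_iff)
qed

definition stable_coeffs :: "('n::finite set \<Rightarrow> real) \<Rightarrow> bool" where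
  "stable_coeffs a \<longleftrightarrow> (\<forall>z :: 'n \<Rightarrow> complex. (\<forall>i. Im (z i) > 0) \<longrightarrow>
     (\<Sum>J\<in>UNIV. complex_of_real (a J) * (\<Prod>i\<in>J. z i)) \<noteq> 0)"

text \<open>
  The imaginary part \<open>z I\<close> is split into two halves: one makes the matrix \<open>Z\<close> lie in the
  Siegel upper half-space, so that its minors are, up to sign, the coefficients of a polynomial
  without zeros in the closed upper half-plane, and the other is
  the point at which the contracted polynomial is evaluated.
\<close>

lemma lift_nonzero_upper_half_plane:
  fixes a :: "'n::finite set \<Rightarrow> real" and M :: "'n \<Rightarrow> 'n \<Rightarrow> real"
  assumes a: "stable_coeffs a" and sym: "\<And>i j. M i j = M j i" and z: "Im z > 0"
  shows "lift (\<lambda>J. of_real (a J)) (add_diag (\<lambda>i j. of_real (M i j)) (\<lambda>_. z)) \<noteq> 0"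
proof -
  define Z where "Z = add_diag (\<lambda>i j. complex_of_real (M i j)) (\<lambda>_. z / 2)"
  have "(\<Sum>J\<in>UNIV. of_real (a J) * (\<Sum>K\<in>Pow J. pminor Z K * (\<Prod>i\<in>J - K. z / 2))) \<noteq> 0"
  proof (rule contraction_nonzero)
    show "(\<Sum>J\<in>UNIV. complex_of_real (a J) * (\<Prod>i\<in>J. x i)) \<noteq> 0"
      if "\<And>i. Im (x i) > 0" for x using a that by (simp add: stable_coeffs_def)
    show "Im (z / 2) > 0" using z by simp
    fix y :: "'n \<Rightarrow> complex" assume y: "\<And>i. Im (y i) \<ge> 0"
    have "(\<Sum>K\<in>UNIV. pminor Z K * (\<Prod>i\<in>K. - y i))
        = pminor (add_diag (\<lambda>i j. - y i * Z i j) (\<lambda>_. 1)) UNIV"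
      unfolding pminor_add_diag[OF finite] pminor_scale_rows by (simp add: mult.commute)
    also have "\<dots> = det (\<chi> i j. add_diag (\<lambda>i j. - y i * Z i j) (\<lambda>_. 1) i j)"
      by (simp add: pminor_def det_def)
    also have "\<dots> \<noteq> 0"
      unfolding Z_def using sym z y by (intro det_upper_half_plane_nonzero) auto
    finally show "(\<Sum>K\<in>UNIV. pminor Z K * (\<Prod>i\<in>K. - y i)) \<noteq> 0" .
  qed
  moreover have "add_diag Z (\<lambda>_. z / 2) = add_diag (\<lambda>i j. of_real (M i j)) (\<lambda>_. z)"
    by (auto simp: Z_def add_diag_def fun_eq_iff)
  ultimately show ?thesis by (simp only: lift_add_diag[symmetric] not_False_eq_True)
qed

lemma coeffs_prod_linear_factors:
  fixes A :: "'a::comm_ring_1 multiset"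
  shows "degree (\<Prod>x\<in>#A. [:- x, 1:]) \<le> size A \<and> coeff (\<Prod>x\<in>#A. [:- x, 1:]) (size A) = 1
     \<and> (A \<noteq> {#} \<longrightarrow> coeff (\<Prod>x\<in>#A. [:- x, 1:]) (size A - 1) = - \<Sum>\<^sub># A)"
proof (induction A)
  case (add x A)
  let ?P = "\<Prod>x\<in>#A. [:- x, 1:]"
  have P: "(\<Prod>y\<in>#add_mset x A. [:- y, 1:]) = pCons 0 ?P - smult x ?P" by simp
  have deg: "degree ?P \<le> size A" and lead: "coeff ?P (size A) = 1"
    and next_lead: "A \<noteq> {#} \<Longrightarrow> coeff ?P (size A - 1) = - \<Sum>\<^sub># A"
    using add.IH by auto
  have "degree (pCons 0 ?P - smult x ?P) \<le> Suc (size A)"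
    using deg by (intro degree_diff_le) (auto intro: order.trans[OF degree_pCons_le] order.trans[OF degree_smult_le])
  moreover have "coeff ?P (Suc (size A)) = 0" using deg by (intro coeff_eq_0) auto
  moreover have "coeff (pCons 0 ?P) (size A) = - \<Sum>\<^sub># A"
    using next_lead by (cases "A = {#}") (auto simp: coeff_pCons split: nat.split)
  ultimately show ?case unfolding P by (simp add: lead)
qed simp

text \<open>
  Real-rootedness together with the first two coefficients. By homogeneity only index sets
  \<open>J\<close> with \<open>d\<close> elements occur, so in the expansion of the minors of \<open>M + t I\<close> the power
  \<open>t\<^sup>d\<close> comes from \<open>K = {}\<close> and \<open>t\<^bsup>d-1\<^esup>\<close> from singletons \<open>K\<close>. The sum of the roots is therefore
  a function of the diagonal of \<open>M\<close> alone.
\<close>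

lemma lift_factors_on_diagonal_line:
  fixes a :: "'n::finite set \<Rightarrow> real" and M :: "'n \<Rightarrow> 'n \<Rightarrow> real"
  assumes hom: "\<And>J. a J \<noteq> 0 \<Longrightarrow> card J = d" and a: "stable_coeffs a"
    and sym: "\<And>i j. M i j = M j i" and L: "sum a UNIV \<noteq> 0"
  shows "\<exists>R. size R = d \<and> sum a UNIV * \<Sum>\<^sub># R = - (\<Sum>J\<in>UNIV. a J * (\<Sum>i\<in>J. M i i))
           \<and> (\<forall>t. lift a (add_diag M (\<lambda>_. t)) = sum a UNIV * (\<Prod>r\<in>#R. t - r))"
proof -
  let ?L = "complex_of_real (sum a UNIV)"
  define N where "N i j = complex_of_real (M i j)" for i j
  (* The factorization is taken over the complex numbers; afterwards all roots are real. *)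
  define q :: "complex poly" where
    "q = (\<Sum>J\<in>UNIV. \<Sum>K\<in>Pow J. monom (of_real (a J) * pminor N K) (card (J - K)))"
  have q: "poly q z = lift (\<lambda>J. of_real (a J)) (add_diag N (\<lambda>_. z))" for z
    by (simp add: q_def poly_sum poly_monom lift_add_diag sum_distrib_left mult.assoc)
  have q_real: "poly q (of_real t) = of_real (lift a (add_diag M (\<lambda>_. t)))" for t
    unfolding q lift_of_real[symmetric]
    by (rule arg_cong[of _ _ "lift _"]) (auto simp: add_diag_def N_def fun_eq_iff)
  have cnj_q: "poly q (cnj z) = cnj (poly q z)" for z
    unfolding q lift_cnj[symmetric] complex_cnj_complex_of_real
    by (rule arg_cong[of _ _ "lift _"]) (auto simp: add_diag_def N_def fun_eq_iff)
  have real_root: "Im z = 0" if "poly q z = 0" for z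
  proof (rule ccontr)
    assume "Im z \<noteq> 0"
    have nz: "poly q u \<noteq> 0" if "Im u > 0" for u
      unfolding q N_def by (rule lift_nonzero_upper_half_plane[OF a sym that])
    from \<open>Im z \<noteq> 0\<close> show False using nz[of z] nz[of "cnj z"] cnj_q[of z] that by force
  qed
  have card_le: "card (J - K) \<le> d" if "a J \<noteq> 0" for J K
    using hom[OF that] card_mono[of J "J - K"] by auto
  have deg_le: "degree q \<le> d"
    unfolding q_def
  proof (intro degree_sum_le)
    fix J K
    show "degree (monom (complex_of_real (a J) * pminor N K) (card (J - K))) \<le> d"
      using card_le[of J K] by (cases "a J = 0") (auto intro: order.trans[OF degree_monom_le])
  qed auto
  have coeff_q: "coeff q k
      = (\<Sum>J\<in>UNIV. of_real (a J) * (\<Sum>K\<in>Pow J. if card (J - K) = k then pminor N K else 0))" for k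
    by (simp add: q_def coeff_sum sum_distrib_left if_distrib cong: if_cong)
  have card_diff: "card (J - K) = d - card K" "card K \<le> d" if "a J \<noteq> 0" "K \<subseteq> J" for J K
    using hom[OF that(1)] that(2) by (auto simp: card_Diff_subset finite_subset[of K J] card_mono)
  have lead: "coeff q d = ?L"
    unfolding coeff_q of_real_sum
  proof (intro sum.cong refl)
    fix J
    show "of_real (a J) * (\<Sum>K\<in>Pow J. if card (J - K) = d then pminor N K else 0) = of_real (a J)"
    proof (cases "a J = 0")
      case False
      have "(\<Sum>K\<in>Pow J. if card (J - K) = d then pminor N K else 0) = (\<Sum>K\<in>{{}}. pminor N K)"
      proof (rule sum.mono_neutral_cong_right)
        show "\<forall>K\<in>Pow J - {{}}. (if card (J - K) = d then pminor N K else 0) = 0"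
        proof
          fix K assume K: "K \<in> Pow J - {{}}"
          then have "card K \<noteq> 0" by (simp add: card_eq_0_iff)
          moreover have "K \<subseteq> J" using K by simp
          ultimately have "card (J - K) \<noteq> d" using card_diff[OF False, of K] by arith
          then show "(if card (J - K) = d then pminor N K else 0) = 0" by simp
        qed
      qed (auto simp: hom[OF False])
      then show ?thesis by simp
    qed simp
  qed
  have deg: "degree q = d" using deg_le lead L le_degree[of q d] by (auto simp del: of_real_sum)
  then have q0: "q \<noteq> 0" using lead L by (auto simp del: of_real_sum)
  obtain A where A: "size A = d" "q = smult ?L (\<Prod>x\<in>#A. [:- x, 1:])"
    using alg_closed_imp_factorization[OF q0] deg lead by auto
  have poly_A: "poly q z = ?L * (\<Prod>x\<in>#A. z - x)" for z
    unfolding A(2) by (simp add: poly_prod_mset image_mset.compositionality o_def)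
  define R where "R = image_mset Re A"
  have "image_mset complex_of_real R = image_mset id A"
    unfolding R_def image_mset.compositionality o_def
  proof (rule image_mset_cong)
    fix x assume "x \<in># A"
    then have "poly q x = 0" unfolding poly_A by auto
    then show "complex_of_real (Re x) = id x" using real_root by (simp add: complex_eq_iff)
  qed
  then have A_R: "A = image_mset complex_of_real R" by simp
  have "sum a UNIV * \<Sum>\<^sub># R = - (\<Sum>J\<in>UNIV. a J * (\<Sum>i\<in>J. M i i))"
  proof (cases "d = 0")
    case True
    then have "a J = 0 \<or> J = {}" for J using hom[of J] by auto
    then have "a J * (\<Sum>i\<in>J. M i i) = 0" for J by (metis mult_eq_0_iff sum.empty)
    then have "(\<Sum>J\<in>UNIV. a J * (\<Sum>i\<in>J. M i i)) = 0" by (intro sum.neutral) blast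
    moreover have "R = {#}" using A True by (simp add: R_def)
    ultimately show ?thesis by simp
  next
    case False
    have "coeff q (d - 1) = (\<Sum>J\<in>UNIV. of_real (a J) * (\<Sum>i\<in>J. N i i))"
      unfolding coeff_q
    proof (intro sum.cong refl)
      fix J
      show "complex_of_real (a J) * (\<Sum>K\<in>Pow J. if card (J - K) = d - 1 then pminor N K else 0)
          = of_real (a J) * (\<Sum>i\<in>J. N i i)"
      proof (cases "a J = 0")
        case aJ: False
        have "(\<Sum>K\<in>Pow J. if card (J - K) = d - 1 then pminor N K else 0)
            = (\<Sum>K\<in>(\<lambda>i. {i}) ` J. pminor N K)"
        proof (rule sum.mono_neutral_cong_right)
          show "\<forall>K\<in>Pow J - (\<lambda>i. {i}) ` J. (if card (J - K) = d - 1 then pminor N K else 0) = 0"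
          proof
            fix K assume K: "K \<in> Pow J - (\<lambda>i. {i}) ` J"
            have "card K \<noteq> 1"
            proof
              assume "card K = 1"
              then obtain i where "K = {i}" by (rule card_1_singletonE)
              then show False using K by auto
            qed
            moreover have "K \<subseteq> J" using K by simp
            ultimately have "card (J - K) \<noteq> d - 1" using card_diff[OF aJ, of K] False by arith
            then show "(if card (J - K) = d - 1 then pminor N K else 0) = 0" by simp
          qed
        qed (use hom[OF aJ] in auto)
        also have "\<dots> = (\<Sum>i\<in>J. N i i)" by (simp add: sum.reindex)
        finally show ?thesis by simp
      qed simp
    qed
    also have "\<dots> = of_real (\<Sum>J\<in>UNIV. a J * (\<Sum>i\<in>J. M i i))" by (simp add: N_def)
    finally have "coeff q (d - 1) = of_real (\<Sum>J\<in>UNIV. a J * (\<Sum>i\<in>J. M i i))" .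
    moreover have "coeff q (d - 1) = ?L * - \<Sum>\<^sub># A"
      using coeffs_prod_linear_factors[of A] A False by (auto simp del: of_real_sum)
    moreover have "\<Sum>\<^sub># A = of_real (\<Sum>\<^sub># R)" unfolding A_R by (induction R) auto
    ultimately have "complex_of_real (sum a UNIV * - \<Sum>\<^sub># R)
        = of_real (\<Sum>J\<in>UNIV. a J * (\<Sum>i\<in>J. M i i))" by (simp del: of_real_sum)
    then show ?thesis unfolding of_real_eq_iff by simp
  qed
  moreover have "lift a (add_diag M (\<lambda>_. t)) = sum a UNIV * (\<Prod>r\<in>#R. t - r)" for t
  proof -
    have "(\<Prod>x\<in>#A. of_real t - x) = complex_of_real (\<Prod>r\<in>#R. t - r)"
      unfolding A_R by (induction R) auto
    then have "complex_of_real (lift a (add_diag M (\<lambda>_. t))) = of_real (sum a UNIV * (\<Prod>r\<in>#R. t - r))"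
      unfolding q_real[symmetric] poly_A by (simp del: of_real_sum)
    then show ?thesis unfolding of_real_eq_iff .
  qed
  moreover have "size R = d" using A by (simp add: R_def)
  ultimately show ?thesis by blast
qed

section \<open>Pencils of real-rooted functions\<close>

lemma prod_mset_positive:
  fixes f :: "'a \<Rightarrow> real"
  assumes "\<And>r. r \<in># R \<Longrightarrow> 0 < f r"
  shows "0 < (\<Prod>r\<in>#R. f r)"
  using assms by (induction R) auto

lemma prod_mset_mono_nonneg:
  fixes f g :: "'a \<Rightarrow> real"
  assumes "\<And>r. r \<in># R \<Longrightarrow> 0 \<le> f r \<and> f r \<le> g r"
  shows "0 \<le> (\<Prod>r\<in>#R. f r) \<and> (\<Prod>r\<in>#R. f r) \<le> (\<Prod>r\<in>#R. g r)"
  using assms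
proof (induction R)
  case (add x R)
  then have "0 \<le> (\<Prod>r\<in>#R. f r)" "(\<Prod>r\<in>#R. f r) \<le> (\<Prod>r\<in>#R. g r)" "0 \<le> f x" "f x \<le> g x" by auto
  then show ?case by (auto intro!: mult_mono mult_nonneg_nonneg)
qed simp

text \<open>
  The differences \<open>t - r\<close> are nonnegative, so each of them is at most their sum. Hence
  a bound on the sum of the roots bounds the value at any point to the right of them.
\<close>

lemma prod_mset_le_power_sum:
  fixes R :: "real multiset"
  assumes "\<And>r. r \<in># R \<Longrightarrow> r \<le> t"
  shows "(\<Prod>r\<in>#R. t - r) \<le> (real (size R) * t - \<Sum>\<^sub># R) ^ size R"
proof -
  have sum: "real (size R) * t - \<Sum>\<^sub># R = (\<Sum>r\<in>#R. t - r)"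
    by (induction R) (auto simp: algebra_simps)
  have "t - r \<le> (\<Sum>r\<in>#R. t - r)" if r: "r \<in># R" for r
  proof -
    obtain R' where R': "R = add_mset r R'" using r by (metis mset_add)
    have "\<forall>r\<in>#R'. r \<le> t" using assms by (auto simp: R')
    then have "0 \<le> (\<Sum>r\<in>#R'. t - r)" by (induction R') auto
    then show ?thesis by (simp add: R')
  qed
  then have "(\<Prod>r\<in>#R. t - r) \<le> (\<Prod>r\<in>#R. (\<Sum>r\<in>#R. t - r))"
    using assms by (intro prod_mset_mono_nonneg[THEN conjunct2]) simp
  then show ?thesis by (simp add: sum)
qed

text \<open>
  Suppose that \<open>b t0 > a t0\<close>, and let \<open>f w\<close> be the member \<open>a + w (b - a)\<close> of the pencil. Since the
  value at \<open>t0\<close> increases with \<open>w\<close>, no root crosses \<open>t0\<close> as \<open>w\<close> grows from \<open>1\<close>. A double root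
  cannot emerge to the right of \<open>t0\<close> either: as long as all roots are to the left of \<open>t0\<close>, real-rootedness
  gives \<open>f w t \<ge> (t - t0)\<^sup>d\<close> for \<open>t \<ge> t0\<close>, and this bound survives in the limit. So all roots
  of \<open>f w\<close> with \<open>w \<ge> 1\<close> lie to the left of \<open>t0\<close>. Their sum is \<open>e\<close>, so \<open>f w t0\<close> is bounded in
  \<open>w\<close>, which contradicts its linear growth.
\<close>

lemma real_rooted_pencil_le:
  fixes a b :: "real \<Rightarrow> real"
  assumes rr: "\<And>w. w \<ge> 0 \<Longrightarrow> \<exists>R. size R = d \<and> \<Sum>\<^sub># R = e \<and>
                 (\<forall>t. a t + w * (b t - a t) = (\<Prod>r\<in>#R. t - r))"
    and pos: "\<And>t. t > 0 \<Longrightarrow> b t > 0"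
    and t0: "t0 > 0"
  shows "b t0 \<le> a t0"
proof (rule ccontr)
  assume "\<not> b t0 \<le> a t0"
  then have slope: "b t0 - a t0 > 0" by simp
  define f where "f w t = a t + w * (b t - a t)" for w t
  define good where "good w \<longleftrightarrow> (\<forall>t\<ge>t0. f w t > 0)" for w
  have "\<forall>w. \<exists>R. w \<ge> 0 \<longrightarrow> size R = d \<and> \<Sum>\<^sub># R = e \<and> (\<forall>t. f w t = (\<Prod>r\<in>#R. t - r))"
    using rr unfolding f_def by blast
  then obtain R where "\<forall>w. w \<ge> 0 \<longrightarrow> size (R w) = d \<and> \<Sum>\<^sub># (R w) = e
      \<and> (\<forall>t. f w t = (\<Prod>r\<in>#R w. t - r))"
    unfolding choice_iff by blast
  then have R: "size (R w) = d" "\<Sum>\<^sub># (R w) = e" "f w t = (\<Prod>r\<in>#R w. t - r)" if "w \<ge> 0" for w t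
    using that by blast+
  have f1: "f 1 t > 0" if "t > 0" for t using pos[OF that] by (simp add: f_def)
  have ft0: "f w t0 > 0" if "w \<ge> 1" for w
  proof -
    have "f w t0 = f 1 t0 + (w - 1) * (b t0 - a t0)" by (simp add: f_def algebra_simps)
    also have "\<dots> > 0" using f1[OF t0] slope that by (intro add_pos_nonneg) auto
    finally show ?thesis .
  qed
  have root_less: "r < t0" if "good w" "w \<ge> 0" "r \<in># R w" for w r
  proof (rule ccontr)
    assume "\<not> r < t0"
    then have "f w r > 0" using that by (simp add: good_def)
    moreover have "f w r = 0"
      using that by (subst R(3)) (auto simp: image_iff)
    ultimately show False by simp
  qed
  have lower: "f w t \<ge> (t - t0) ^ d" if "good w" "w \<ge> 0" "t \<ge> t0" for w t
  proof -
    have "(\<Prod>r\<in>#R w. t - t0) \<le> (\<Prod>r\<in>#R w. t - r)"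
      using root_less[OF that(1,2)] that(3)
      by (intro prod_mset_mono_nonneg[THEN conjunct2]) force
    then show ?thesis using that by (simp add: R)
  qed
  have cont: "continuous_on UNIV (f w)" if "w \<ge> 0" for w
  proof -
    have "f w = (\<lambda>t. \<Prod>r\<in>#R w. t - r)" using R(3)[OF that] by (rule ext)
    moreover have "continuous_on UNIV (\<lambda>t. \<Prod>r\<in>#S. t - r)" for S :: "real multiset"
      by (induction S) (auto intro!: continuous_intros)
    ultimately show ?thesis by (simp only:)
  qed
  have "a = f 0" "b = f 1" by (simp_all add: f_def fun_eq_iff)
  then have cont_ab: "continuous_on UNIV a" "continuous_on UNIV b" using cont[of 0] cont[of 1] by simp_all
  have all_good: "good w" if w1: "w \<ge> 1" for w
  proof (rule ccontr)
    assume "\<not> good w"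
    (* T bounds the zeros and the nonpositive values of the pencil to the right of t0, for all
       parameters between 1 and w: at t > T both f 1 and f w are positive, and the members in
       between are convex combinations of them. *)
    define T where "T = t0 + (\<Sum>r\<in>#R w. \<bar>r\<bar>)"
    have bound: "t \<le> T" if t: "t \<ge> t0" "f w' t \<le> 0" "1 \<le> w'" "w' \<le> w" for w' t
    proof (rule ccontr)
      assume tT: "\<not> t \<le> T"
      have "f w t > 0"
      proof -
        have "t - r > 0" if r: "r \<in># R w" for r
        proof -
          obtain R' where R': "R w = add_mset r R'" using r by (metis mset_add)
          have "0 \<le> (\<Sum>r\<in>#R'. \<bar>r\<bar>)" by (induction R') auto
          then show ?thesis using tT t0 unfolding T_def R' by simp
        qed
        then have "(\<Prod>r\<in>#R w. t - r) > 0" by (rule prod_mset_positive)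
        then show ?thesis using w1 by (simp add: R)
      qed
      moreover have "f 1 t > 0" using f1 t0 t by auto
      ultimately have "(w - w') * f 1 t + (w' - 1) * f w t > 0"
      proof (cases "w' = w")
        case True
        then have "w \<noteq> 1" using t \<open>f 1 t > 0\<close> by auto
        then show ?thesis using True w1 \<open>f w t > 0\<close> by simp
      next
        case False
        then show ?thesis using t \<open>f 1 t > 0\<close> \<open>f w t > 0\<close> by (intro add_pos_nonneg) auto
      qed
      moreover have "(w - w') * f 1 t + (w' - 1) * f w t = (w - 1) * f w' t"
        by (simp add: f_def algebra_simps)
      moreover have "(w - 1) * f w' t \<le> 0" using t w1 by (intro mult_nonneg_nonpos) auto
      ultimately show False by simp
    qed
    (* By compactness there is a first parameter w' at which a nonpositive value occurs. *)
    define B where "B = ({1..w} \<times> {t0..T}) \<inter> {p. f (fst p) (snd p) \<le> 0}"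
    have "closed {p. f (fst p) (snd p) \<le> 0}" unfolding f_def
      by (intro closed_Collect_le continuous_intros continuous_on_compose2[OF cont_ab(1)]
            continuous_on_compose2[OF cont_ab(2)]) auto
    then have "compact B" unfolding B_def by (intro compact_Int_closed compact_Times) auto
    then have "compact (fst ` B)" by (intro compact_continuous_image continuous_intros)
    moreover have "B \<noteq> {}"
    proof -
      obtain t where "t \<ge> t0" "f w t \<le> 0" using \<open>\<not> good w\<close> by (auto simp: good_def not_less)
      then have "(w, t) \<in> B" using bound[of t w] w1 by (auto simp: B_def)
      then show ?thesis by blast
    qed
    ultimately obtain w' where w': "w' \<in> fst ` B" "\<And>u. u \<in> fst ` B \<Longrightarrow> w' \<le> u"
      using compact_attains_inf[of "fst ` B"] by auto
    then obtain t where t: "1 \<le> w'" "w' \<le> w" "t0 \<le> t" "f w' t \<le> 0" by (auto simp: B_def)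
    have "w' \<noteq> 1" using t f1[of t] t0 by auto
    then have w'1: "1 < w'" using t by simp
    have below: "good u" if u: "1 \<le> u" "u < w'" for u
    proof (rule ccontr)
      assume "\<not> good u"
      then obtain t' where "t' \<ge> t0" "f u t' \<le> 0" by (auto simp: good_def not_less)
      then have "(u, t') \<in> B" using bound[of t' u] u t by (auto simp: B_def)
      then show False using w'(2)[of u] u by force
    qed
    have "f w' t \<ge> (t - t0) ^ d"
    proof (rule continuous_ge_on_closure[where S = "{1..<w'}" and f = "\<lambda>u. f u t"])
      show "continuous_on (closure {1..<w'}) (\<lambda>u. f u t)"
        unfolding f_def by (intro continuous_intros)
      show "w' \<in> closure {1..<w'}" using w'1 by simp
      show "(t - t0) ^ d \<le> f u t" if "u \<in> {1..<w'}" for u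
        using that lower[OF below] t by simp
    qed
    then have "\<not> t - t0 > 0" using t zero_less_power[of "t - t0" d] by linarith
    then have "t = t0" using t by simp
    then show False using ft0[of w'] t by simp
  qed
  have bounded: "f w t0 \<le> (real d * t0 - e) ^ d" if "w \<ge> 1" for w
    using prod_mset_le_power_sum[of "R w" t0] root_less[OF all_good[OF that]] that
    by (simp add: R less_imp_le)
  define C where "C = \<bar>(real d * t0 - e) ^ d\<bar> + \<bar>a t0\<bar>"
  (* The parameter at which the value at t0 is b t0 + C, above the bound. *)
  define w where "w = 1 + C / (b t0 - a t0)"
  have "w \<ge> 1" using slope by (simp add: w_def C_def)
  moreover have "f w t0 = b t0 + C" using slope by (simp add: f_def w_def field_simps)
  moreover have "b t0 > 0" using pos t0 by simp
  ultimately show False using bounded[of w] by (simp add: C_def)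
qed

section \<open>Removal of the off-diagonal entries\<close>

definition scale_cross :: "'a::comm_ring_1 \<Rightarrow> 'n \<Rightarrow> ('n \<Rightarrow> 'n \<Rightarrow> 'a) \<Rightarrow> 'n \<Rightarrow> 'n \<Rightarrow> 'a" where
  "scale_cross s i M = (\<lambda>j k. (if (j = i) \<noteq> (k = i) then s else 1) * M j k)"

text \<open>
  Unless \<open>\<sigma>\<close> fixes \<open>i\<close>, it selects exactly two scaled entries: one in row \<open>i\<close> and one in
  column \<open>i\<close>.
\<close>

lemma prod_scale_cross:
  assumes J: "finite J" and \<sigma>: "\<sigma> permutes J"
  shows "(\<Prod>j\<in>J. scale_cross s i M j (\<sigma> j)) = (if \<sigma> i = i then 1 else s\<^sup>2) * (\<Prod>j\<in>J. M j (\<sigma> j))"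
proof -
  have "(\<Prod>j\<in>J. if (j = i) \<noteq> (\<sigma> j = i) then s else 1) = (if \<sigma> i = i then 1 else s\<^sup>2)"
  proof (cases "\<sigma> i = i")
    case True
    then have "\<sigma> j = i \<longleftrightarrow> j = i" for j using inj_eq[OF permutes_inj[OF \<sigma>], of j i] by simp
    then show ?thesis using True by simp
  next
    case False
    obtain k where k: "\<sigma> k = i" using surjD[OF permutes_surj[OF \<sigma>], of i] by auto
    have *: "\<sigma> j = i \<longleftrightarrow> j = k" for j using inj_eq[OF permutes_inj[OF \<sigma>], of j k] k by simp
    have iJ: "i \<in> J" "k \<in> J" "i \<noteq> k" using False k by (metis permutes_not_in[OF \<sigma>])+
    have "(\<Prod>j\<in>J. if (j = i) \<noteq> (\<sigma> j = i) then s else 1) = (\<Prod>j\<in>{i,k}. if (j = i) \<noteq> (\<sigma> j = i) then s else 1)"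
      using iJ J * by (intro prod.mono_neutral_right) auto
    also have "\<dots> = s\<^sup>2" using iJ * by (auto simp: power2_eq_square)
    finally show ?thesis using False by simp
  qed
  then show ?thesis by (simp add: scale_cross_def prod.distrib)
qed

text \<open>
  The identity holds termwise: a permutation that fixes \<open>i\<close> contributes equally to all
  three lifts, and any other contributes nothing to the lift with scale \<open>0\<close>.
\<close>

lemma lift_scale_cross:
  "lift a (scale_cross s i M)
     = lift a (scale_cross 0 i M) + s\<^sup>2 * (lift a M - lift a (scale_cross 0 i M))"
proof -
  have 1: "pminor (scale_cross s i M) J
     = pminor (scale_cross 0 i M) J + s\<^sup>2 * (pminor M J - pminor (scale_cross 0 i M) J)" for s J
  proof -
    have "pminor (scale_cross s i M) J = (\<Sum>\<sigma> | \<sigma> permutes J.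
       of_int (sign \<sigma>) * ((if \<sigma> i = i then 1 else s\<^sup>2) * (\<Prod>j\<in>J. M j (\<sigma> j))))" for s
      unfolding pminor_def by (intro sum.cong refl) (simp add: prod_scale_cross)
    then show ?thesis
      unfolding pminor_def[of M]
      by (simp add: sum_subtractf[symmetric] sum_distrib_left sum.distrib[symmetric])
         (intro sum.cong, auto simp: algebra_simps)
  qed
  show ?thesis unfolding lift_def
    by (simp add: sum_subtractf[symmetric] sum_distrib_left sum.distrib[symmetric])
       (intro sum.cong refl, subst 1, simp add: algebra_simps)
qed

text \<open>
  The pencil has the parameter \<open>w = s\<^sup>2\<close>, where \<open>s\<close> scales the entries of row and column
  \<open>i\<close>. Scaling does not change the diagonal, so the sum of the roots is the same for all \<open>w\<close>.
  Division by \<open>sum a UNIV\<close>, the value of \<open>p\<close> at \<open>(1,\<dots>,1)\<close>, makes the members monic and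
  covers both signs of \<open>p\<close>.
\<close>

lemma lift_le_zero_cross:
  fixes a :: "'n::finite set \<Rightarrow> real" and M :: "'n \<Rightarrow> 'n \<Rightarrow> real"
  assumes hom: "\<And>J. a J \<noteq> 0 \<Longrightarrow> card J = d" and a: "stable_coeffs a"
    and sym: "\<And>i j. M i j = M j i" and L: "sum a UNIV \<noteq> 0"
    and pos: "\<And>t. t > 0 \<Longrightarrow> lift a (add_diag M (\<lambda>_. t)) / sum a UNIV > 0"
    and t: "t > 0"
  shows "lift a (add_diag M (\<lambda>_. t)) / sum a UNIV
     \<le> lift a (add_diag (scale_cross 0 i M) (\<lambda>_. t)) / sum a UNIV"
proof (rule real_rooted_pencil_le[OF _ pos t])
  let ?L = "sum a UNIV"
  define e where "e = - (\<Sum>J\<in>UNIV. a J * (\<Sum>i\<in>J. M i i)) / ?L"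
  have scale_add: "scale_cross s i (add_diag M (\<lambda>_. t)) = add_diag (scale_cross s i M) (\<lambda>_. t)" for s t
    by (auto simp: scale_cross_def add_diag_def fun_eq_iff)
  fix w :: real assume w: "w \<ge> 0"
  let ?M = "scale_cross (sqrt w) i M"
  have "?M j k = ?M k j" for j k using sym[of j k] by (simp add: scale_cross_def)
  then obtain R where R: "size R = d" "?L * \<Sum>\<^sub># R = - (\<Sum>J\<in>UNIV. a J * (\<Sum>j\<in>J. ?M j j))"
      "\<And>t. lift a (add_diag ?M (\<lambda>_. t)) = ?L * (\<Prod>r\<in>#R. t - r)"
    using lift_factors_on_diagonal_line[OF hom a _ L, of ?M] by blast
  have "\<Sum>\<^sub># R = e" using R(2) L by (simp add: e_def scale_cross_def field_simps)
  moreover have "lift a (add_diag (scale_cross 0 i M) (\<lambda>_. t)) / ?L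
      + w * (lift a (add_diag M (\<lambda>_. t)) / ?L - lift a (add_diag (scale_cross 0 i M) (\<lambda>_. t)) / ?L)
      = (\<Prod>r\<in>#R. t - r)" for t
  proof -
    have "lift a (add_diag ?M (\<lambda>_. t)) = lift a (add_diag (scale_cross 0 i M) (\<lambda>_. t))
       + w * (lift a (add_diag M (\<lambda>_. t)) - lift a (add_diag (scale_cross 0 i M) (\<lambda>_. t)))"
      using lift_scale_cross[of a "sqrt w" i "add_diag M (\<lambda>_. t)"] w by (simp add: scale_add)
    then show ?thesis unfolding R(3) using L by (simp add: field_simps)
  qed
  ultimately show "\<exists>R. size R = d \<and> \<Sum>\<^sub># R = e \<and> (\<forall>t. lift a (add_diag (scale_cross 0 i M) (\<lambda>_. t)) / ?L
      + w * (lift a (add_diag M (\<lambda>_. t)) / ?L - lift a (add_diag (scale_cross 0 i M) (\<lambda>_. t)) / ?L)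
      = (\<Prod>r\<in>#R. t - r))"
    using R(1) by blast
qed

definition zero_crosses :: "'n set \<Rightarrow> ('n \<Rightarrow> 'n \<Rightarrow> real) \<Rightarrow> 'n \<Rightarrow> 'n \<Rightarrow> real" where
  "zero_crosses S M = (\<lambda>i j. if i \<noteq> j \<and> (i \<in> S \<or> j \<in> S) then 0 else M i j)"

text \<open>
  The inequality for one step also carries positivity over to the new matrix, which is
  what the next step needs.
\<close>

lemma lift_le_zero_crosses:
  fixes a :: "'n::finite set \<Rightarrow> real" and M :: "'n \<Rightarrow> 'n \<Rightarrow> real"
  assumes hom: "\<And>J. a J \<noteq> 0 \<Longrightarrow> card J = d" and a: "stable_coeffs a"
    and sym: "\<And>i j. M i j = M j i" and L: "sum a UNIV \<noteq> 0"
    and pos: "\<And>t. t > 0 \<Longrightarrow> lift a (add_diag M (\<lambda>_. t)) / sum a UNIV > 0"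
    and t: "t > 0"
  shows "lift a (add_diag M (\<lambda>_. t)) / sum a UNIV
     \<le> lift a (add_diag (zero_crosses S M) (\<lambda>_. t)) / sum a UNIV"
  using finite[of S] t
proof (induction S arbitrary: t rule: finite_induct)
  case empty
  then show ?case by (simp add: zero_crosses_def)
next
  case (insert i S)
  have step: "scale_cross 0 i (zero_crosses S M) = zero_crosses (insert i S) M"
    by (auto simp: scale_cross_def zero_crosses_def fun_eq_iff)
  have "lift a (add_diag (zero_crosses S M) (\<lambda>_. t)) / sum a UNIV > 0" if "t > 0" for t
    using pos[OF that] insert.IH[OF that] by linarith
  moreover have "zero_crosses S M j k = zero_crosses S M k j" for j k
    using sym[of j k] by (auto simp: zero_crosses_def)
  ultimately have "lift a (add_diag (zero_crosses S M) (\<lambda>_. t)) / sum a UNIV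
     \<le> lift a (add_diag (zero_crosses (insert i S) M) (\<lambda>_. t)) / sum a UNIV"
    unfolding step[symmetric] using insert.prems
    by (intro lift_le_zero_cross[OF hom a _ L]) blast+
  then show ?case using insert.IH[OF insert.prems] by linarith
qed

section \<open>Multiaffine polynomials as functions on sets of variables\<close>

lemma lookup_squarefree_monom:
  "Poly_Mapping.lookup (squarefree_monom J) i = (if i \<in> J then 1 else 0)"
  by (simp add: squarefree_monom_def lookup_sum lookup_single when_def)

lemma eval_poly_multiaffine:
  fixes p :: "('n::finite) rpoly" and x :: "('a::real_field) ^ 'n"
  assumes "multiaffine p"
  shows "eval_poly p x
    = (\<Sum>J\<in>UNIV. of_real (Poly_Mapping.lookup p (squarefree_monom J)) * (\<Prod>i\<in>J. x $ i))"
proof -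
  let ?f = "\<lambda>m. of_real (Poly_Mapping.lookup p m) * (\<Prod>i\<in>UNIV. (x $ i) ^ Poly_Mapping.lookup m i)"
  have inj: "inj (squarefree_monom :: 'n set \<Rightarrow> _)"
  proof (rule injI)
    fix J K :: "'n set" assume eq: "squarefree_monom J = squarefree_monom K"
    have "(if i \<in> J then 1 else 0) = (if i \<in> K then 1 else 0 :: nat)" for i
      unfolding lookup_squarefree_monom[symmetric] eq ..
    then have "i \<in> J \<longleftrightarrow> i \<in> K" for i by (metis zero_neq_one)
    then show "J = K" by blast
  qed
  have keys: "Poly_Mapping.keys p \<subseteq> range squarefree_monom"
  proof
    fix m assume "m \<in> Poly_Mapping.keys p"
    then have le: "Poly_Mapping.lookup m i \<le> 1" for i using assms by (auto simp: multiaffine_def)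
    have "m = squarefree_monom {i. Poly_Mapping.lookup m i = 1}"
    proof (rule poly_mapping_eqI)
      fix i
      show "Poly_Mapping.lookup m i = Poly_Mapping.lookup (squarefree_monom {i. Poly_Mapping.lookup m i = 1}) i"
        using le[of i] by (simp add: lookup_squarefree_monom)
    qed
    then show "m \<in> range squarefree_monom" by blast
  qed
  have "eval_poly p x = (\<Sum>m\<in>range squarefree_monom. ?f m)"
    unfolding eval_poly_def using keys
    by (intro sum.mono_neutral_left) (auto simp: Poly_Mapping.in_keys_iff)
  also have "\<dots> = (\<Sum>J\<in>UNIV. ?f (squarefree_monom J))"
    using inj by (simp add: sum.reindex)
  also have "\<dots> = (\<Sum>J\<in>UNIV. of_real (Poly_Mapping.lookup p (squarefree_monom J)) * (\<Prod>i\<in>J. x $ i))"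
    by (simp add: lookup_squarefree_monom if_distrib prod.If_cases cong: if_cong)
  finally show ?thesis .
qed

section \<open>The minor lift and the diagonal\<close>

theorem corollary2p2:
  fixes p :: "('n::finite) rpoly" and A :: "real ^ 'n ^ 'n"
  assumes "homogeneous p" and "multiaffine p" and "stable_poly p"
    and "transpose A = A"
    and "A \<in> hyperbolicity_cone (minor_lift p) (mat 1)"
  shows "(eval_poly p (1 :: real ^ 'n) > 0 \<longrightarrow> eval_poly p (diag_vec A) \<ge> minor_lift p A)
       \<and> diag_vec A \<in> hyperbolicity_cone (eval_poly p) (1 :: real ^ 'n)"
proof -
  define a :: "'n set \<Rightarrow> real" where "a J = Poly_Mapping.lookup p (squarefree_monom J)" for J
  define M where "M i j = A $ i $ j" for i j
  define D where "D = zero_crosses UNIV M"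
  let ?L = "sum a UNIV"
  have eval: "eval_poly p x = (\<Sum>J\<in>UNIV. of_real (a J) * (\<Prod>i\<in>J. x $ i))" for x :: "('b::real_field)^'n"
    unfolding a_def by (rule eval_poly_multiaffine[OF \<open>multiaffine p\<close>])
  have eval_1: "eval_poly p (1 :: real ^ 'n) = ?L" by (simp add: eval)
  have minor: "minor_lift p B = lift a (\<lambda>i j. B $ i $ j)" for B
    by (simp add: minor_lift_def lift_def a_def principal_minor_def pminor_def)
  have minor_line: "minor_lift p (A - t *\<^sub>R mat 1) = lift a (add_diag M (\<lambda>_. - t))" for t
    unfolding minor by (rule arg_cong[of _ _ "lift a"]) (auto simp: fun_eq_iff mat_def add_diag_def M_def)
  have D: "add_diag D (\<lambda>_. t) = add_diag (\<lambda>_ _. 0) (\<lambda>i. A $ i $ i + t)" for t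
    by (auto simp: fun_eq_iff add_diag_def D_def zero_crosses_def M_def)
  have eval_line: "eval_poly p (diag_vec A - t *\<^sub>R 1) = lift a (add_diag D (\<lambda>_. - t))" for t
    by (simp add: eval D lift_add_diag_zero diag_vec_def)
  have sym: "M i j = M j i" for i j
    using arg_cong[OF \<open>transpose A = A\<close>, of "\<lambda>B. B $ j $ i"] by (simp add: M_def transpose_def)
  have sym_D: "D i j = D j i" for i j using sym[of i j] by (auto simp: D_def zero_crosses_def)
  obtain d where d: "\<And>m. m \<in> Poly_Mapping.keys p \<Longrightarrow> (\<Sum>i\<in>UNIV. Poly_Mapping.lookup m i) = d"
    using \<open>homogeneous p\<close> unfolding homogeneous_def by blast
  have hom: "card J = d" if "a J \<noteq> 0" for J
    using d[of "squarefree_monom J"] that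
    by (simp add: a_def Poly_Mapping.in_keys_iff lookup_squarefree_monom sum.If_cases)
  have stable: "stable_coeffs a"
    unfolding stable_coeffs_def
  proof (intro allI impI)
    fix z :: "'n \<Rightarrow> complex" assume "\<forall>i. Im (z i) > 0"
    then have "eval_poly p (\<chi> i. z i) \<noteq> 0" using \<open>stable_poly p\<close> by (simp add: stable_poly_def)
    then show "(\<Sum>J\<in>UNIV. complex_of_real (a J) * (\<Prod>i\<in>J. z i)) \<noteq> 0" by (simp add: eval)
  qed
  (* By homogeneity the value at (i,...,i) is a multiple of the value at (1,...,1). *)
  have L: "?L \<noteq> 0"
  proof
    assume L0: "?L = 0"
    have "(\<Sum>J\<in>UNIV. complex_of_real (a J) * (\<Prod>i\<in>J. \<i>)) = (\<Sum>J\<in>UNIV. complex_of_real (a J) * \<i> ^ d)"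
      using hom by (intro sum.cong refl) (auto simp: mult_eq_0_iff)
    also have "\<dots> = complex_of_real ?L * \<i> ^ d" by (simp add: sum_distrib_right)
    finally show False using stable[unfolded stable_coeffs_def, rule_format, of "\<lambda>_. \<i>"] L0 by simp
  qed
  obtain R where R: "lift a (add_diag M (\<lambda>_. t)) = ?L * (\<Prod>r\<in>#R. t - r)" for t
    using lift_factors_on_diagonal_line[of a d M, OF hom stable sym L] by blast
  obtain R' where R': "lift a (add_diag D (\<lambda>_. t)) = ?L * (\<Prod>r\<in>#R'. t - r)" for t
    using lift_factors_on_diagonal_line[of a d D, OF hom stable sym_D L] by blast
  have roots: "r \<le> 0" if "r \<in># R" for r
  proof -
    have "lift a (add_diag M (\<lambda>_. - (- r))) = 0" using that by (auto simp: R)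
    then have "minor_lift p (A - (- r) *\<^sub>R mat 1) = 0" by (simp only: minor_line)
    then have "0 \<le> - r"
      using \<open>A \<in> hyperbolicity_cone _ _\<close> unfolding hyperbolicity_cone_def by blast
    then show ?thesis by simp
  qed
  have pos: "lift a (add_diag M (\<lambda>_. t)) / ?L > 0" if "t > 0" for t
  proof -
    have "(\<Prod>r\<in>#R. t - r) > 0" using roots that by (intro prod_mset_positive) fastforce
    then show ?thesis using L by (simp add: R)
  qed
  have le: "lift a (add_diag M (\<lambda>_. t)) / ?L \<le> lift a (add_diag D (\<lambda>_. t)) / ?L" if "t > 0" for t
    unfolding D_def by (rule lift_le_zero_crosses[of a d M, OF hom stable sym L pos that])
  have "diag_vec A \<in> hyperbolicity_cone (eval_poly p) (1 :: real ^ 'n)"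
    unfolding hyperbolicity_cone_def
  proof (intro CollectI allI impI, rule ccontr)
    fix t :: real assume "eval_poly p (diag_vec A - t *\<^sub>R 1) = 0" "\<not> 0 \<le> t"
    then show False using pos[of "- t"] le[of "- t"] by (simp add: eval_line)
  qed
  moreover have "minor_lift p A \<le> eval_poly p (diag_vec A)" if "?L > 0"
  proof -
    (* At t = 0 the polynomial of A may vanish, so the inequality is extended from t > 0 by
       continuity. *)
    have cont: "continuous_on S (\<lambda>t. \<Prod>r\<in>#Q. t - r)" for S and Q :: "real multiset"
      by (induction Q) (auto intro!: continuous_intros)
    have "0 \<le> (\<Prod>r\<in>#R'. 0 - r) - (\<Prod>r\<in>#R. 0 - r)"
    proof (rule continuous_ge_on_closure[where S = "{0<..}"
          and f = "\<lambda>t. (\<Prod>r\<in>#R'. t - r) - (\<Prod>r\<in>#R. t - r)"])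
      show "0 \<le> (\<Prod>r\<in>#R'. t - r) - (\<Prod>r\<in>#R. t - r)" if "t \<in> {0<..}" for t
        using le[of t] that L by (simp add: R R')
    qed (auto intro!: continuous_intros cont)
    then have "lift a (add_diag M (\<lambda>_. - 0)) \<le> lift a (add_diag D (\<lambda>_. - 0))"
      using that by (simp add: R R')
    then show ?thesis unfolding minor_line[symmetric] eval_line[symmetric] by simp
  qed
  ultimately show ?thesis unfolding eval_1 by blast
qed

end
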